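(* Let $r\ge3$ and let $n$ be an integer with $n>\varphi^2 r$, where $\varphi=\frac{1+\sqrt5}{2}$. Let $G\subseteq[n]$ and suppose $\mathcal{A}=F(r,n,\{G\})$ is intersecting. Let $X\subseteq[2,n]$ be eventually EKR (for $r$). Then $|\mathcal{A}(X)|\le|\mathcal{S}_{n,r}(X)|$.
   Context: For integers $a\le b$, $[a,b]=\{a,\dots,b\}$ and $[n]=[1,n]$. $\binom{[n]}{r}$ is the set of $r$-element subsets of $[n]$; sets are listed increasingly. A family $\mathcal{A}\subseteq\binom{[n]}{r}$ is intersecting if any two members intersect. Compression order: for $A,B\in\binom{[n]}{r}$, $A\le B$ iff $a_i\le b_i$ for all $i$; $\mathcal{A}$ is compressed if $A\in\mathcal{A}$, $B\le A$ imply $B\in\mathcal{A}$. For $A=\{a_1<\dots<a_r\}$ and $C=\{c_1<\dots<c_k\}$, write $A\prec C$ if $r\ge k$ and $a_i\le c_i$ for $1\le i\le k$. For $\mathcal{G}\subseteq 2^{[n]}$, $F(r,n,\mathcal{G})=\{A\in\binom{[n]}{r}: A\prec G\text{ for some }G\in\mathcal{G}\}$. For a set $X$, $\mathcal{A}(X)=\{A\in\mathcal{A}:A\cap X\ne\emptyset\}$, and $\mathcal{S}_{n,r}=\{A\in\binom{[n]}{r}:1\in A\}$. A set $X\subseteq[2,n]$ is EKR (for $n,r$) if $|\mathcal{A}(X)|\le|\mathcal{S}_{n,r}(X)|$ for every compressed intersecting family $\mathcal{A}\subseteq\binom{[n]}{r}$. For fixed $r$, a finite set $X\subset\{2,3,\dots\}$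 is eventually EKR if it is EKR for $n,r$ for all sufficiently large $n$. *)

theory Defs
  imports Complex_Main "HOL-Library.Ramsey"
begin

text \<open>
  The family of \<open>r\<close>-element subsets of \<open>{1..n}\<close> is \<open>nsets {1..n} r\<close>. The increasing listing of a
  finite set \<open>A\<close> is \<open>sorted_list_of_set A\<close>, so its elements are indexed from \<open>0\<close>.
\<close>

definition intersecting :: "'a set set \<Rightarrow> bool" where
  "intersecting \<A> \<longleftrightarrow> (\<forall>A\<in>\<A>. \<forall>B\<in>\<A>. A \<inter> B \<noteq> {})"

text \<open>Meaningful for finite sets of equal cardinality.\<close>

definition compression_le :: "nat set \<Rightarrow> nat set \<Rightarrow> bool" where
  "compression_le A B \<longleftrightarrow>
     (\<forall>i < card A. sorted_list_of_set A ! i \<le> sorted_list_of_set B ! i)"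

definition compressed :: "nat \<Rightarrow> nat \<Rightarrow> nat set set \<Rightarrow> bool" where
  "compressed n r \<A> \<longleftrightarrow> \<A> \<subseteq> nsets {1..n} r \<and>
     (\<forall>A\<in>\<A>. \<forall>B\<in>nsets {1..n} r. compression_le B A \<longrightarrow> B \<in> \<A>)"

definition prec :: "nat set \<Rightarrow> nat set \<Rightarrow> bool" where
  "prec A C \<longleftrightarrow> card C \<le> card A \<and>
     (\<forall>i < card C. sorted_list_of_set A ! i \<le> sorted_list_of_set C ! i)"

definition generated_family :: "nat \<Rightarrow> nat \<Rightarrow> nat set set \<Rightarrow> nat set set" where
  "generated_family r n \<G> = {A \<in> nsets {1..n} r. \<exists>G\<in>\<G>. prec A G}"

definition hitting :: "'a set set \<Rightarrow> 'a set \<Rightarrow> 'a set set" where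
  "hitting \<A> X = {A \<in> \<A>. A \<inter> X \<noteq> {}}"

definition star :: "nat \<Rightarrow> nat \<Rightarrow> nat set set" where
  "star n r = {A \<in> nsets {1..n} r. 1 \<in> A}"

definition EKR :: "nat \<Rightarrow> nat \<Rightarrow> nat set \<Rightarrow> bool" where
  "EKR n r X \<longleftrightarrow> X \<subseteq> {2..n} \<and>
     (\<forall>\<A>. compressed n r \<A> \<and> intersecting \<A> \<longrightarrow>
        card (hitting \<A> X) \<le> card (hitting (star n r) X))"

definition eventually_EKR :: "nat \<Rightarrow> nat set \<Rightarrow> bool" where
  "eventually_EKR r X \<longleftrightarrow> finite X \<and> X \<subseteq> {2..} \<and> (\<forall>\<^sub>F n in sequentially. EKR n r X)"

end

theory Submission
  imports Defs
begin

text \<open>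
  If \<open>F(r,n,{G})\<close> is intersecting, then some \<open>g\<^sub>i \<le> 2i - 1\<close>, since otherwise it contains both
  \<open>{2,4,\<dots>,2r}\<close> and \<open>{1,3,\<dots>,2r-1}\<close>. So it is contained in the family of all \<open>A\<close> with
  \<open>|A \<inter> [2i-1]| \<ge> i\<close>. Put \<open>u = i - 1\<close> and \<open>B = [2,2u+1]\<close>. Members of the star outside this
  family contain \<open>1\<close> and meet \<open>B\<close> in fewer than \<open>u\<close> points; members of the family outside the
  star avoid \<open>1\<close> and meet \<open>B\<close> in more than \<open>u\<close> points. Reflecting the intersection size at \<open>u\<close>
  pairs the binomial sums that count the two kinds of sets.

  The comparison for \<open>X\<close> is obtained by enlarging a small base set. Adding a point of \<open>B\<close>
  changes the lead of the star by a quantity of the same shape for \<open>u - 1\<close>, which is nonnegative.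
  Adding a point outside \<open>B\<close> changes it by the same quantity for \<open>r - 1\<close>, whose sign is monotone
  in \<open>r\<close>. The base sets consist of at most one point of \<open>B\<close> and at most one point outside, or two
  points outside if \<open>u = 1\<close>. Those for which the comparison fails are excluded by eventual EKR,
  tested on the family \<open>|A \<inter> [3]| \<ge> 2\<close> and on the Hilton--Milner family of \<open>[2,r+1]\<close>.
  The constant \<open>\<phi>\<^sup>2\<close> comes from the case \<open>u = 1\<close>, which amounts to \<open>(1 - p)\<^sup>2 > p\<close> for \<open>p = r/n\<close>.
\<close>

subsection \<open>Binomial sums\<close>

text \<open>By unimodality: \<open>c\<close> is at least as close to \<open>N / 2\<close> as
  \<open>a\<close>. If \<open>c\<close> lies beyond the middle, its mirror image
  \<open>N - c\<close> does not and is still at least \<open>a\<close>.\<close>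

lemma choose_le_choose:
  fixes a c N :: nat
  assumes "a \<le> c" "a + c \<le> N"
  shows "N choose a \<le> N choose c"
proof (cases "2 * c \<le> N")
  case True
  then show ?thesis using assms by (intro binomial_mono) auto
next
  case False
  then have "N choose a \<le> N choose (N - c)"
    using assms by (intro binomial_mono) auto
  then show ?thesis
    using assms by (simp add: binomial_symmetric[of c N])
qed

lemma Suc_times_choose_Suc: "Suc k * (N choose Suc k) = (N - k) * (N choose k)"
  using binomial_absorption[of k N] binomial_absorb_comp[of N k] by simp

text \<open>For \<open>k > r\<close> truncated subtraction would turn
  \<open>L choose (r - k)\<close> into 1. The guard makes such terms vanish, since no set of size
  \<open>r\<close> has more than \<open>r\<close> prescribed points.\<close>

definition shifted_choose :: "nat \<Rightarrow> nat \<Rightarrow> nat \<Rightarrow> nat" where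
  "shifted_choose L r k = (if k \<le> r then L choose (r - k) else 0)"

lemma shifted_choose_Suc_Suc: "shifted_choose L (Suc r) (Suc k) = shifted_choose L r k"
  by (simp add: shifted_choose_def)

lemma shifted_choose_pascal:
  "shifted_choose (Suc L) (Suc r) k = shifted_choose L (Suc r) k + shifted_choose L r k"
  by (auto simp: shifted_choose_def Suc_diff_le le_Suc_eq)

lemma shifted_choose_le:
  assumes "k \<le> l" "2 * r \<le> L + k + l"
  shows "shifted_choose L r l \<le> shifted_choose L r k"
  using assms by (auto simp: shifted_choose_def intro!: choose_le_choose)

text \<open>
  The surplus of the star over the family of all \<open>A\<close> with \<open>|A \<inter> [2u+1]| \<ge> u + 1\<close>, counting sets in a
  ground set that consists of \<open>1\<close>, of \<open>b \<le> 2u\<close> further points of \<open>[2u+1]\<close>, and of \<open>L\<close> points beyond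
  \<open>2u + 1\<close>. The shift \<open>Suc k\<close> accounts for the point \<open>1\<close>.
\<close>

definition excess :: "nat \<Rightarrow> nat \<Rightarrow> nat \<Rightarrow> nat \<Rightarrow> real" where
  "excess u b L r = (\<Sum>k<u. real (b choose k) * shifted_choose L r (Suc k)
                         - real (b choose (2 * u - k)) * shifted_choose L r (2 * u - k))"

text \<open>Pascal's rule splits the count by whether the new point is used; removing it leaves a
  set of size \<open>r\<close>.\<close>

lemma excess_Suc_outside: "excess u b (Suc L) (Suc r) = excess u b L (Suc r) + excess u b L r"
  unfolding excess_def sum.distrib[symmetric]
  by (intro sum.cong refl) (simp add: shifted_choose_pascal algebra_simps)

text \<open>Removing the new inside point lowers both the set size and the intersection size by 1,
  so the threshold \<open>Suc u\<close> becomes \<open>u\<close>. The bound on \<open>b\<close>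
  kills the leftover term at \<open>k = 0\<close>, which contains
  \<open>b choose (2 * u + 1)\<close>.\<close>

lemma excess_Suc_inside:
  assumes "b \<le> 2 * u"
  shows "excess (Suc u) (Suc b) L (Suc r) = excess (Suc u) b L (Suc r) + excess u b L r"
proof -
  have "excess (Suc u) (Suc b) L (Suc r) - excess (Suc u) b L (Suc r) =
     (\<Sum>k<Suc u. (real (Suc b choose k) - real (b choose k)) * shifted_choose L (Suc r) (Suc k)
       - (real (Suc b choose (2 * Suc u - k)) - real (b choose (2 * Suc u - k)))
           * shifted_choose L (Suc r) (2 * Suc u - k))"
    unfolding excess_def sum_subtractf[symmetric]
    by (intro sum.cong refl) (simp only: algebra_simps)
  also have "\<dots> = excess u b L r"
    unfolding sum.lessThan_Suc_shift excess_def using assms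
    by (auto simp: Suc_diff_le shifted_choose_Suc_Suc intro!: sum.cong)
  finally show ?thesis by simp
qed

text \<open>The comparison is termwise and factorwise. In \<open>b choose _\<close> the two indices
  add up to \<open>2 * u >= b\<close>, so \<open>2 * u - k\<close> is the one farther from the
  middle; in \<open>shifted_choose\<close> they add up to \<open>2 * u + 1\<close>, and the bound on
  \<open>r\<close> has the same effect.\<close>

lemma excess_nonneg:
  assumes "b \<le> 2 * u" "2 * r \<le> L + 2 * u + 1"
  shows "0 \<le> excess u b L r"
  unfolding excess_def
proof (intro sum_nonneg)
  fix k assume "k \<in> {..<u}"
  then have "b choose (2 * u - k) \<le> b choose k"
  proof (cases "2 * u - k \<le> b")
    case True
    then have "b choose (2 * u - k) = b choose (b - (2 * u - k))"
      by (rule binomial_symmetric)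
    also have "\<dots> \<le> b choose k"
      using assms \<open>k \<in> {..<u}\<close> True by (intro choose_le_choose) auto
    finally show ?thesis .
  qed (simp add: binomial_eq_0)
  moreover have "shifted_choose L r (2 * u - k) \<le> shifted_choose L r (Suc k)"
    using assms \<open>k \<in> {..<u}\<close> by (intro shifted_choose_le) auto
  ultimately show "0 \<le> real (b choose k) * shifted_choose L r (Suc k)
                  - real (b choose (2 * u - k)) * shifted_choose L r (2 * u - k)"
    by (simp add: mult_mono del: of_nat_mult flip: of_nat_mult)
qed

text \<open>The pivot is the quotient of consecutive binomial coefficients at \<open>s = u\<close>.
  The cross-multiplied form also covers \<open>s > r\<close>, where the quotient makes no
  sense.\<close>

lemma shifted_choose_ratio:
  assumes "u \<le> r"
  shows "s \<le> u \<Longrightarrow> real (Suc r - u) * shifted_choose L (Suc r) s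
           \<le> real (L - (r - u)) * shifted_choose L r s"
    and "u < s \<Longrightarrow> real (L - (r - u)) * shifted_choose L r s
           \<le> real (Suc r - u) * shifted_choose L (Suc r) s"
proof -
  have eq: "(Suc r - s) * shifted_choose L (Suc r) s = (L - (r - s)) * shifted_choose L r s"
    if "s \<le> r"
    using that Suc_times_choose_Suc[of "r - s" L]
    by (simp add: shifted_choose_def Suc_diff_le)
  {
    assume "s \<le> u"
    have "(Suc r - s) * ((Suc r - u) * shifted_choose L (Suc r) s)
        = (Suc r - u) * ((L - (r - s)) * shifted_choose L r s)"
      using eq \<open>s \<le> u\<close> assms by simp
    also have "\<dots> \<le> (Suc r - s) * ((L - (r - u)) * shifted_choose L r s)"
      using \<open>s \<le> u\<close> by (simp only: mult.assoc[symmetric], intro mult_mono) auto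
    finally have "(Suc r - u) * shifted_choose L (Suc r) s \<le> (L - (r - u)) * shifted_choose L r s"
      using \<open>s \<le> u\<close> assms by (elim mult_left_le_imp_le) auto
    then show "real (Suc r - u) * shifted_choose L (Suc r) s
           \<le> real (L - (r - u)) * shifted_choose L r s"
      by (simp del: of_nat_mult flip: of_nat_mult)
  next
    assume "u < s"
    show "real (L - (r - u)) * shifted_choose L r s
           \<le> real (Suc r - u) * shifted_choose L (Suc r) s"
    proof (cases "s \<le> r")
      case True
      have "(Suc r - s) * ((L - (r - u)) * shifted_choose L r s)
         \<le> (Suc r - u) * ((L - (r - s)) * shifted_choose L r s)"
        using \<open>u < s\<close> by (simp only: mult.assoc[symmetric], intro mult_mono) auto
      also have "\<dots> = (Suc r - s) * ((Suc r - u) * shifted_choose L (Suc r) s)"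
        using eq True by simp
      finally have "(L - (r - u)) * shifted_choose L r s \<le> (Suc r - u) * shifted_choose L (Suc r) s"
        using True by (elim mult_left_le_imp_le) auto
      then show ?thesis
        by (simp del: of_nat_mult flip: of_nat_mult)
    qed (simp add: shifted_choose_def)
  }
qed

text \<open>
  Raising \<open>r\<close> multiplies the term at \<open>s\<close> by \<open>(L - r + s) / (r + 1 - s)\<close>, which increases with \<open>s\<close>, and the
  positive terms of the excess are those with \<open>s \<le> u\<close>.
\<close>

lemma excess_nonpos_Suc:
  assumes "u \<le> r" "excess u b L r \<le> 0"
  shows "excess u b L (Suc r) \<le> 0"
proof -
  have "real (Suc r - u) * excess u b L (Suc r) \<le> real (L - (r - u)) * excess u b L r"
    unfolding excess_def sum_distrib_left
  proof (intro sum_mono)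
    fix k assume "k \<in> {..<u}"
    then have "Suc k \<le> u" "u < 2 * u - k" by auto
    then have
      "real (b choose k) * (real (Suc r - u) * shifted_choose L (Suc r) (Suc k))
        \<le> real (b choose k) * (real (L - (r - u)) * shifted_choose L r (Suc k))"
      "real (b choose (2 * u - k)) * (real (L - (r - u)) * shifted_choose L r (2 * u - k))
        \<le> real (b choose (2 * u - k)) * (real (Suc r - u) * shifted_choose L (Suc r) (2 * u - k))"
      by (intro mult_left_mono shifted_choose_ratio assms(1); simp)+
    then show "real (Suc r - u) * (real (b choose k) * real (shifted_choose L (Suc r) (Suc k))
            - real (b choose (2 * u - k)) * real (shifted_choose L (Suc r) (2 * u - k)))
        \<le> real (L - (r - u)) * (real (b choose k) * real (shifted_choose L r (Suc k))
            - real (b choose (2 * u - k)) * real (shifted_choose L r (2 * u - k)))"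
      by (simp only: right_diff_distrib mult_ac)
  qed
  also have "\<dots> \<le> 0"
    using assms(2) by (simp add: mult_nonneg_nonpos)
  finally show ?thesis
    using assms(1) by (simp add: mult_le_0_iff)
qed

text \<open>Inside points are added first, then outside ones. The first inside point moves
  \<open>b\<close> from \<open>2 * u\<close> to \<open>2 * u - 1\<close>, a step that
  \<open>excess_Suc_inside\<close> does not cover because it would need
  \<open>2 * u - 1 <= 2 * (u - 1)\<close>. Hence the base contains an inside point unless none is to
  be added.\<close>

lemma excess_extend:
  assumes "excess u (2 * u - t0) (M - m0) r \<le> excess u (2 * u) M r"
    and "1 \<le> t0 \<or> t = t0" "t0 \<le> t" "t \<le> 2 * u" "m0 \<le> m" "m \<le> M" "u < r"
    and "2 * r \<le> (M - m0) + 2 * u + 1"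
  shows "excess u (2 * u - t) (M - m) r \<le> excess u (2 * u) M r"
  using \<open>m0 \<le> m\<close> \<open>m \<le> M\<close>
proof (induction m rule: dec_induct)
  case base
  show ?case using \<open>t0 \<le> t\<close> \<open>1 \<le> t0 \<or> t = t0\<close> \<open>t \<le> 2 * u\<close>
  proof (induction t rule: dec_induct)
    case base
    then show ?case using assms(1) by simp
  next
    case (step t)
    then obtain v where v: "u = Suc v" by (cases u) auto
    obtain q where q: "r = Suc q" using \<open>u < r\<close> by (cases r) auto
    have "2 * u - Suc t \<le> 2 * v" "2 * u - t = Suc (2 * u - Suc t)" using v step by auto
    then have "excess u (2 * u - t) (M - m0) r =
       excess u (2 * u - Suc t) (M - m0) r + excess v (2 * u - Suc t) (M - m0) q"
      using excess_Suc_inside[of "2 * u - Suc t" v "M - m0" q] v q by simp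
    moreover have "0 \<le> excess v (2 * u - Suc t) (M - m0) q"
      using \<open>2 * u - Suc t \<le> 2 * v\<close> assms v q by (intro excess_nonneg) auto
    ultimately show ?case using step by auto
  qed
next
  case (step m)
  obtain q where q: "r = Suc q" using \<open>u < r\<close> by (cases r) auto
  have "M - m = Suc (M - Suc m)" using step by auto
  then have eq: "excess u (2 * u - t) (M - m) r =
     excess u (2 * u - t) (M - Suc m) r + excess u (2 * u - t) (M - Suc m) q"
    using excess_Suc_outside[of u "2 * u - t" "M - Suc m" q] q by simp
  show ?case
  proof (cases "0 \<le> excess u (2 * u - t) (M - Suc m) q")
    case True
    then show ?thesis using eq step by auto
  next
    \<comment> \<open>A negative excess for \<open>r - 1\<close> forces a nonpositive one for
      \<open>r\<close>, and the excess of the full ground set is nonnegative.\<close>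
    case False
    then have "excess u (2 * u - t) (M - Suc m) r \<le> 0"
      using excess_nonpos_Suc[of u q] assms q by auto
    also have "\<dots> \<le> excess u (2 * u) M r"
      using assms by (intro excess_nonneg) auto
    finally show ?thesis .
  qed
qed

subsection \<open>The base sets\<close>

text \<open>For \<open>i = 0\<close> the quotient of the two coefficients is exactly
  \<open>x / y\<close>. Passing from \<open>i\<close> to \<open>i + 1\<close> multiplies it by
  \<open>(x^2 - j^2) / (y^2 - j^2)\<close> with \<open>j = i + 1\<close>, which is at least
  \<open>(x / y)^2\<close> because \<open>y <= x\<close>.\<close>

lemma choose_ratio_ge_power:
  fixes x y i :: nat
  assumes "y \<le> x" "i < y"
  shows "(real x / real y) ^ (2 * i + 1) * real ((x + y - 1) choose (y - Suc i))
           \<le> real ((x + y - 1) choose (y + i))"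
  using \<open>i < y\<close>
proof (induction i)
  case 0
  then have "y * ((x + y - 1) choose y) = x * ((x + y - 1) choose (y - 1))"
    using Suc_times_choose_Suc[of "y - 1" "x + y - 1"] by simp
  then have "real y * real ((x + y - 1) choose y) = real x * real ((x + y - 1) choose (y - 1))"
    by (metis of_nat_mult)
  then show ?case using 0 by (simp add: field_simps)
next
  case (Suc i)
  define M where "M = x + y - 1"
  define f g f' g' where "f = real (M choose (y + i))" and "g = real (M choose (y - Suc i))"
    and "f' = real (M choose (y + Suc i))" and "g' = real (M choose (y - Suc (Suc i)))"
  define j where "j = real (Suc i)"
  define \<rho> where "\<rho> = (real x / real y) ^ (2 * i + 1)"
  have j: "0 < j" "j < y" "real y \<le> real x" using Suc.prems assms by (auto simp: j_def)
  have IH: "\<rho> * g \<le> f" using Suc by (simp add: f_def g_def \<rho>_def M_def)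
  have "(y + Suc i) * (M choose (y + Suc i)) = (x - Suc i) * (M choose (y + i))"
    using Suc_times_choose_Suc[of "y + i" M] Suc.prems assms by (simp add: M_def)
  then have "real (y + Suc i) * f' = real (x - Suc i) * f"
    unfolding f'_def f_def by (metis of_nat_mult)
  then have f': "f' = (real x - j) / (real y + j) * f"
    using j assms Suc.prems by (simp add: field_simps j_def of_nat_diff)
  have "(y - Suc i) * (M choose (y - Suc i)) = (x + Suc i) * (M choose (y - Suc (Suc i)))"
    using Suc_times_choose_Suc[of "y - Suc (Suc i)" M] Suc.prems assms
    by (simp add: M_def Suc_diff_Suc)
  then have "real (y - Suc i) * g = real (x + Suc i) * g'"
    unfolding g'_def g_def by (metis of_nat_mult)
  then have g: "g = (real x + j) / (real y - j) * g'"
    using j assms Suc.prems by (simp add: field_simps j_def of_nat_diff)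
  have "(real x / real y)\<^sup>2 \<le> (real x - j) * (real x + j) / ((real y + j) * (real y - j))"
  proof -
    have "(real x)\<^sup>2 * ((real y + j) * (real y - j)) = (real x * real y)\<^sup>2 - (real x * j)\<^sup>2"
      by (simp add: power2_eq_square algebra_simps)
    also have "\<dots> \<le> (real x * real y)\<^sup>2 - (real y * j)\<^sup>2"
      using j by (simp add: power_mono mult_right_mono)
    also have "\<dots> = (real x - j) * (real x + j) * (real y)\<^sup>2"
      by (simp add: power2_eq_square algebra_simps)
    finally show ?thesis
      using j by (intro mult_imp_le_div_pos) (simp_all add: power_divide pos_divide_le_eq)
  qed
  then have "\<rho> * (real x / real y)\<^sup>2 * g'
      \<le> \<rho> * ((real x - j) * (real x + j) / ((real y + j) * (real y - j))) * g'"
    by (intro mult_right_mono mult_left_mono) (auto simp: \<rho>_def g'_def)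
  also have "\<dots> = (real x - j) / (real y + j) * (\<rho> * g)"
    by (simp add: g)
  also have "\<dots> \<le> (real x - j) / (real y + j) * f"
    using IH j by (intro mult_left_mono) auto
  also have "\<dots> = f'" by (simp add: f')
  finally show ?case
    by (simp add: \<rho>_def f'_def g'_def M_def power2_eq_square mult_ac)
qed

text \<open>The base set is a single inside point. By Pascal's rule and absorption, the term at
  \<open>k\<close> only requires \<open>(2 * u - k) / k\<close> to be at most the quotient estimated
  in \<open>choose_ratio_ge_power\<close>. The condition \<open>r < 2 * u\<close> makes
  \<open>k\<close> positive in every term whose negative part survives.\<close>

lemma excess_base_inside:
  fixes n r u :: nat
  assumes "13 * r \<le> 5 * n" "2 \<le> u" "u < r" "r < 2 * u"
  shows "excess u (2 * u - 1) (n - 1 - 2 * u) r \<le> excess u (2 * u) (n - 1 - 2 * u) r"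
  unfolding excess_def
proof (intro sum_mono)
  define M x y where "M = n - 1 - 2 * u" and "x = n - r - u" and "y = r - u"
  fix k assume "k \<in> {..<u}"
  then have k: "k < u" by simp
  have xy: "M = x + y - 1" "2 * y \<le> x" "1 \<le> y"
    using assms by (auto simp: M_def x_def y_def)
  have pascal_hi: "2 * u choose (2 * u - k) = (2 * u - 1 choose k) + (2 * u - 1 choose (2 * u - k))"
    using k assms binomial_symmetric[of k "2 * u - 1"]
    by (subst choose_reduce_nat) (auto simp: add.commute diff_commute)
  show "real (2 * u - 1 choose k) * real (shifted_choose (n - 1 - 2 * u) r (Suc k)) -
         real (2 * u - 1 choose (2 * u - k)) * real (shifted_choose (n - 1 - 2 * u) r (2 * u - k))
      \<le> real (2 * u choose k) * real (shifted_choose (n - 1 - 2 * u) r (Suc k)) -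
         real (2 * u choose (2 * u - k)) * real (shifted_choose (n - 1 - 2 * u) r (2 * u - k))"
  proof (cases "2 * u - k \<le> r")
    case False
    then show ?thesis
      by (simp add: shifted_choose_def binomial_right_mono mult_right_mono)
  next
    case True
    \<comment> \<open>With \<open>i\<close> the distance of \<open>k\<close> from
      \<open>u - 1\<close>, the two lower indices become \<open>y + i\<close> and
      \<open>y - Suc i\<close>, the pair treated in \<open>choose_ratio_ge_power\<close>.\<close>
    define i where "i = u - k - 1"
    have i: "i < y" "Suc i < u" "k = u - Suc i" "1 \<le> k"
      using True k assms by (auto simp: i_def y_def)
    have idx: "r - Suc k = y + i" "r - (2 * u - k) = y - Suc i" "Suc k \<le> r"
      using True k assms by (auto simp: i_def y_def)
    have sc: "shifted_choose (n - 1 - 2 * u) r (Suc k) = M choose (y + i)"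
      "shifted_choose (n - 1 - 2 * u) r (2 * u - k) = M choose (y - Suc i)"
      using True idx by (auto simp: shifted_choose_def M_def)
    have growth: "real (u + Suc i) \<le> (real x / real y) ^ (2 * i + 1) * real (u - Suc i)"
    proof (cases "i = 0")
      case True
      have "y * (u + 1) \<le> x * (u - 1)"
      proof -
        have "r * (u + 1) \<le> (n - r) * (u - 1) + 2 * u"
        proof -
          have "8 * r \<le> 5 * (n - r)" using assms(1) by linarith
          \<comment> \<open>For \<open>5 <= u\<close> one has
            \<open>5 * (u + 1) <= 8 * (u - 1)\<close>. For smaller \<open>u\<close> the bound
            \<open>r < 2 * u\<close> keeps \<open>r\<close> so small that the summand
            \<open>2 * u\<close> makes up the difference.\<close>
          consider "u = 2" | "u = 3" | "u = 4" | "5 \<le> u" using assms(2) by linarith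
          then show ?thesis
          proof cases
            case 1
            then have "r = 3" using assms by linarith
            then have "5 \<le> n - r" using \<open>8 * r \<le> 5 * (n - r)\<close> by linarith
            then show ?thesis using \<open>r = 3\<close> 1 by simp
          next
            case 2
            then have "r \<le> 5" using assms by linarith
            then show ?thesis using 2 \<open>8 * r \<le> 5 * (n - r)\<close> by simp
          next
            case 3
            then have "r \<le> 7" using assms by linarith
            then show ?thesis using 3 \<open>8 * r \<le> 5 * (n - r)\<close> by simp
          next
            case 4
            have "5 * (r * (u + 1)) \<le> 8 * r * (u - 1)"
              using 4 by (cases u) auto
            also have "\<dots> \<le> 5 * (n - r) * (u - 1)"
              using assms by (intro mult_right_mono) auto
            finally show ?thesis by linarith
          qed
        qed
        moreover have "r = y + u" "n - r = x + u" using assms by (auto simp: x_def y_def)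
        then have "r * (u + 1) = y * (u + 1) + u * (u + 1)"
          "(n - r) * (u - 1) = x * (u - 1) + u * (u - 1)"
          by (metis add_mult_distrib)+
        moreover have "u * (u + 1) = u * (u - 1) + 2 * u"
          using assms by (cases u) auto
        ultimately show ?thesis by linarith
      qed
      then have "real y * real (u + 1) \<le> real x * real (u - 1)"
        by (metis of_nat_mono of_nat_mult)
      then show ?thesis using True xy by (simp add: field_simps)
    next
      \<comment> \<open>For \<open>1 <= i\<close> it is enough that \<open>2 <= x / y\<close>, since
        \<open>2 ^ (2 * i + 1)\<close> already exceeds the largest possible quotient, attained at
        \<open>u - Suc i = 1\<close>.\<close>
      case False
      have pow: "2 * i + 3 \<le> (2::nat) ^ (2 * i + 1)"
        using False
      proof (induction i)
        case (Suc i)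
        then show ?case by (cases "i = 0") auto
      qed simp
      have "u + Suc i \<le> (2 * i + 3) * (u - Suc i)"
      proof -
        obtain d where "u = Suc i + Suc d" using i less_imp_Suc_add[of "Suc i" u] by auto
        then show ?thesis by (simp add: algebra_simps)
      qed
      also have "\<dots> \<le> 2 ^ (2 * i + 1) * (u - Suc i)"
        using pow by (intro mult_right_mono) auto
      finally have "real (u + Suc i) \<le> 2 ^ (2 * i + 1) * real (u - Suc i)"
        by (metis of_nat_mono of_nat_mult of_nat_numeral of_nat_power)
      also have "\<dots> \<le> (real x / real y) ^ (2 * i + 1) * real (u - Suc i)"
        using xy by (intro mult_right_mono power_mono) (auto simp: field_simps)
      finally show ?thesis .
    qed
    have "real (u + Suc i) * (M choose (y - Suc i))
        \<le> (real x / real y) ^ (2 * i + 1) * real (u - Suc i) * (M choose (y - Suc i))"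
      using growth by (rule mult_right_mono) simp
    also have "\<dots> \<le> real (u - Suc i) * (M choose (y + i))"
      using mult_left_mono[OF choose_ratio_ge_power[of y x i], of "real (u - Suc i)"] xy i
      by (simp add: mult_ac)
    finally have "(u + Suc i) * (M choose (y - Suc i)) \<le> (u - Suc i) * (M choose (y + i))"
      by (simp only: of_nat_mult[symmetric] of_nat_le_iff)
    moreover have "u + Suc i = 2 * u - k" "u - Suc i = k" using i by auto
    ultimately have main: "(2 * u - k) * (M choose (y - Suc i)) \<le> k * (M choose (y + i))"
      by (simp only:)
    have absorb: "k * (2 * u - 1 choose k) = (2 * u - k) * (2 * u - 1 choose (k - 1))"
    proof -
      have "Suc (k - 1) = k" "2 * u - 1 - (k - 1) = 2 * u - k" using \<open>1 \<le> k\<close> by auto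
      then show ?thesis using Suc_times_choose_Suc[of "k - 1" "2 * u - 1"] by (simp only:)
    qed
    have "k * ((2 * u - 1 choose k) * (M choose (y - Suc i)))
        = (2 * u - 1 choose (k - 1)) * ((2 * u - k) * (M choose (y - Suc i)))"
      using absorb by (metis mult.assoc mult.commute)
    also have "\<dots> \<le> k * ((2 * u - 1 choose (k - 1)) * (M choose (y + i)))"
      using mult_left_mono[OF main, of "2 * u - 1 choose (k - 1)"] by (simp add: mult_ac)
    finally have "(2 * u - 1 choose k) * (M choose (y - Suc i))
        \<le> (2 * u - 1 choose (k - 1)) * (M choose (y + i))"
      using \<open>1 \<le> k\<close> by (elim mult_left_le_imp_le) auto
    then have "real (2 * u - 1 choose k) * real (M choose (y - Suc i))
        \<le> real (2 * u - 1 choose (k - 1)) * real (M choose (y + i))"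
      by (metis of_nat_mono of_nat_mult)
    moreover have "2 * u choose k = (2 * u - 1 choose (k - 1)) + (2 * u - 1 choose k)"
      using \<open>1 \<le> k\<close> \<open>k < u\<close> by (subst choose_reduce_nat) auto
    ultimately show ?thesis
      unfolding sc pascal_hi by (simp add: algebra_simps)
  qed
qed

text \<open>The base set has one inside and one outside point. Absorption writes \<open>a\<close>
  and \<open>b\<close> as multiples of \<open>c\<close>, and \<open>f'\<close> and \<open>g'\<close>
  as multiples of \<open>f\<close> and \<open>g\<close>. Each term then reduces to
  \<open>key\<close>, which follows from the lower bound on \<open>f / g\<close>.\<close>

lemma excess_base_mixed:
  fixes n r u :: nat
  assumes "13 * r \<le> 5 * n" "2 \<le> u" "u < r"
  shows "excess u (2 * u - 1) (n - 1 - 2 * u - 1) r \<le> excess u (2 * u) (n - 1 - 2 * u) r"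
  unfolding excess_def
proof (intro sum_mono)
  define M x y where "M = n - 1 - 2 * u" and "x = n - r - u" and "y = r - u"
  fix k assume "k \<in> {..<u}"
  then have k: "k < u" by simp
  have xy: "M = x + y - 1" "8 * y \<le> 5 * x" "1 \<le> y" "0 < M"
    using assms by (auto simp: M_def x_def y_def)
  show "real (2 * u - 1 choose k) * real (shifted_choose (n - 1 - 2 * u - 1) r (Suc k)) -
         real (2 * u - 1 choose (2 * u - k)) * real (shifted_choose (n - 1 - 2 * u - 1) r (2 * u - k))
      \<le> real (2 * u choose k) * real (shifted_choose (n - 1 - 2 * u) r (Suc k)) -
         real (2 * u choose (2 * u - k)) * real (shifted_choose (n - 1 - 2 * u) r (2 * u - k))"
  proof (cases "2 * u - k \<le> r")
    case False
    then show ?thesis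
      by (auto simp: shifted_choose_def intro!: binomial_right_mono mult_mono)
  next
    case True
    define i where "i = u - k - 1"
    have i: "i < y" "Suc i \<le> u" "k = u - Suc i"
      using True k assms by (auto simp: i_def y_def)
    define f g c f' g' a b where "f = real (M choose (y + i))" and "g = real (M choose (y - Suc i))"
      and "c = real (2 * u choose k)"
      and "f' = real (M - 1 choose (y + i))" and "g' = real (M - 1 choose (y - Suc i))"
      and "a = real (2 * u - 1 choose k)" and "b = real (2 * u - 1 choose (2 * u - k))"
    define X Y U j where "X = real x" and "Y = real y" and "U = real u" and "j = real (Suc i)"
    have idx: "r - Suc k = y + i" "r - (2 * u - k) = y - Suc i" "Suc k \<le> r"
      using True k assms by (auto simp: i_def y_def)
    have sc: "shifted_choose (n - 1 - 2 * u) r (Suc k) = M choose (y + i)"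
      "shifted_choose (n - 1 - 2 * u) r (2 * u - k) = M choose (y - Suc i)"
      "shifted_choose (n - 1 - 2 * u - 1) r (Suc k) = M - 1 choose (y + i)"
      "shifted_choose (n - 1 - 2 * u - 1) r (2 * u - k) = M - 1 choose (y - Suc i)"
      using True idx by (auto simp: shifted_choose_def M_def)
    have ge: "0 \<le> f" "0 \<le> g" "0 \<le> c" by (auto simp: f_def g_def c_def)
    have bounds: "1 \<le> j" "j \<le> Y" "8 * Y \<le> 5 * X" "j \<le> U" "2 \<le> U" "1 \<le> Y"
      using i xy assms by (auto simp: X_def Y_def U_def j_def simp flip: of_nat_mult)
    have M: "real M = X + Y - 1" using xy by (simp add: X_def Y_def of_nat_diff)
    have a: "a = (U + j) * c / (2 * U)"
    proof -
      have "real (2 * u - k) * c = real (2 * u) * a"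
        unfolding c_def a_def using binomial_absorb_comp[of "2 * u" k] by (metis of_nat_mult)
      then show ?thesis using bounds i by (simp add: U_def j_def field_simps of_nat_diff)
    qed
    have sym: "2 * u choose (2 * u - k) = 2 * u choose k"
      using k by (subst binomial_symmetric) auto
    have b: "b = (U - j) * c / (2 * U)"
    proof -
      have "real (2 * u - (2 * u - k)) * c = real (2 * u) * b"
        unfolding c_def b_def using binomial_absorb_comp[of "2 * u" "2 * u - k"] sym
        by (metis of_nat_mult)
      moreover have "2 * u - (2 * u - k) = k" using k by simp
      moreover have "real k = U - j" using i by (simp add: U_def j_def of_nat_diff)
      ultimately show ?thesis using bounds by (simp add: U_def field_simps)
    qed
    have f': "f' = (X - j) * f / M"
    proof -
      have "real (M - (y + i)) * f = real M * f'"
        unfolding f_def f'_def using binomial_absorb_comp[of M "y + i"] by (metis of_nat_mult)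
      moreover have "real (M - (y + i)) = X - j"
        using i xy by (simp add: X_def j_def of_nat_diff)
      ultimately show ?thesis
        using \<open>0 < M\<close> by (simp add: nonzero_eq_divide_eq mult.commute)
    qed
    have g': "g' = (X + j - 1) * g / M"
    proof -
      have "real (M - (y - Suc i)) * g = real M * g'"
        unfolding g_def g'_def using binomial_absorb_comp[of M "y - Suc i"] by (metis of_nat_mult)
      moreover have "real (M - (y - Suc i)) = X + j - 1"
        using i xy by (simp add: X_def j_def of_nat_diff)
      ultimately show ?thesis
        using \<open>0 < M\<close> by (simp add: nonzero_eq_divide_eq mult.commute)
    qed
    have ratio: "(X / Y) ^ (2 * i + 1) * g \<le> f"
      using choose_ratio_ge_power[of y x i] xy i by (simp add: X_def Y_def f_def g_def)
    have key: "(2 * U * M - (U - j) * (X + j - 1)) * g \<le> (2 * U * M - (U + j) * (X - j)) * f"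
    proof (cases "i = 0")
      \<comment> \<open>The ratio \<open>X / Y\<close> suffices here:
        \<open>8/5 * (8/5 + 1) > 4\<close> and \<open>2 * U <= 4 * (U - 1)\<close>.\<close>
      case True
      have "j = 1" using True by (simp add: j_def)
      have "2 * U * (Y * (Y - 1)) \<le> (U - 1) * (X * (X + Y - 1))"
      proof -
        have "4 * (Y * (Y - 1)) \<le> 8 / 5 * Y * (8 / 5 * Y + Y - 1)"
          using bounds by (simp add: algebra_simps)
        also have "\<dots> \<le> X * (X + Y - 1)"
          using bounds by (intro mult_mono) auto
        finally have "4 * (Y * (Y - 1)) \<le> X * (X + Y - 1)" .
        then have "(U - 1) * (4 * (Y * (Y - 1))) \<le> (U - 1) * (X * (X + Y - 1))"
          using bounds by (intro mult_left_mono) auto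
        moreover have "2 * U * (Y * (Y - 1)) \<le> (U - 1) * 4 * (Y * (Y - 1))"
          using bounds by (intro mult_right_mono) auto
        ultimately show ?thesis by (simp only: mult.assoc)
      qed
      moreover have "X * (2 * U * M - (U + 1) * (X - 1)) - Y * (2 * U * M - (U - 1) * X)
          = (U - 1) * (X * (X + Y - 1)) - 2 * U * (Y * (Y - 1))"
        unfolding M by (simp add: algebra_simps)
      ultimately have "Y * (2 * U * M - (U - 1) * X) \<le> X * (2 * U * M - (U + 1) * (X - 1))"
        by linarith
      then have "2 * U * M - (U - 1) * X \<le> X / Y * (2 * U * M - (U + 1) * (X - 1))"
        using bounds by (simp add: pos_le_divide_eq mult.commute)
      then have "(2 * U * M - (U - 1) * X) * g \<le> X / Y * (2 * U * M - (U + 1) * (X - 1)) * g"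
        by (rule mult_right_mono[OF _ ge(2)])
      also have "\<dots> = (2 * U * M - (U + 1) * (X - 1)) * (X / Y * g)"
        by simp
      also have "\<dots> \<le> (2 * U * M - (U + 1) * (X - 1)) * f"
      proof (intro mult_left_mono)
        show "X / Y * g \<le> f" using ratio True by simp
        have "(U + 1) * (X - 1) \<le> (2 * U) * M"
          using bounds by (intro mult_mono) (auto simp: M)
        then show "0 \<le> 2 * U * M - (U + 1) * (X - 1)" by simp
      qed
      finally show ?thesis using \<open>j = 1\<close> by simp
    next
      \<comment> \<open>Cruder bounds do for \<open>1 <= i\<close>: the left coefficient is at most
        \<open>2 * U * M\<close>, the right one at least \<open>2 * U * (Y + 1)\<close>, and
        \<open>M <= q^3 * (Y + 1)\<close> because \<open>q + 1 <= q^3\<close> for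
        \<open>q >= 8/5\<close>.\<close>
      case False
      define q where "q = X / Y"
      have q: "8 / 5 \<le> q" "X = q * Y" using bounds by (auto simp: q_def field_simps)
      have "q + 1 \<le> 8 / 5 * (8 / 5) * q" using q(1) by simp
      also have "\<dots> \<le> q * q * q"
        using q(1) by (intro mult_mono) auto
      also have "\<dots> = q ^ 3" by (simp add: power3_eq_cube)
      finally have "(q + 1) * (Y + 1) \<le> q ^ 3 * (Y + 1)"
        using bounds by (intro mult_right_mono) auto
      then have "real M \<le> q ^ 3 * (Y + 1)"
        using q by (simp add: M algebra_simps)
      then have "2 * U * M * g \<le> 2 * U * (q ^ 3 * (Y + 1)) * g"
        using ge bounds by (intro mult_left_mono mult_right_mono) auto
      also have "\<dots> = 2 * U * (Y + 1) * (q ^ 3 * g)" by simp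
      also have "\<dots> \<le> 2 * U * (Y + 1) * f"
      proof (intro mult_left_mono)
        have "q ^ 3 \<le> q ^ (2 * i + 1)" using False q by (intro power_increasing) auto
        then have "q ^ 3 * g \<le> q ^ (2 * i + 1) * g" using ge by (intro mult_right_mono)
        also have "\<dots> \<le> f" using ratio by (simp add: q_def)
        finally show "q ^ 3 * g \<le> f" .
      qed (use bounds in auto)
      also have "\<dots> \<le> (2 * U * M - (U + j) * (X - j)) * f"
      proof (intro mult_right_mono ge)
        have "2 \<le> j" using False by (simp add: j_def)
        then have "2 * U * (Y + 1) \<le> 2 * U * (Y - 1 + j)"
          using bounds by (intro mult_left_mono) auto
        moreover have "(U + j) * (X - j) \<le> 2 * U * (X - j)"
          using bounds by (intro mult_right_mono) auto
        ultimately show "2 * U * (Y + 1) \<le> 2 * U * M - (U + j) * (X - j)"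
          by (simp add: M algebra_simps)
      qed
      finally have "2 * U * M * g \<le> (2 * U * M - (U + j) * (X - j)) * f" .
      moreover have "(2 * U * M - (U - j) * (X + j - 1)) * g \<le> 2 * U * M * g"
        using bounds ge by (intro mult_right_mono) auto
      ultimately show ?thesis by linarith
    qed
    have "c * g - b * g' = c / (2 * U * M) * ((2 * U * M - (U - j) * (X + j - 1)) * g)"
      using \<open>2 \<le> U\<close> \<open>0 < M\<close> by (simp add: b g' field_simps)
    also have "\<dots> \<le> c / (2 * U * M) * ((2 * U * M - (U + j) * (X - j)) * f)"
      using key ge bounds by (intro mult_left_mono) auto
    also have "\<dots> = c * f - a * f'"
      using \<open>2 \<le> U\<close> \<open>0 < M\<close> by (simp add: a f' field_simps)
    finally show ?thesis
      unfolding sc sym by (simp add: a_def b_def c_def f_def g_def f'_def g'_def)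
  qed
qed

text \<open>The constant 13/5 is the lower bound \<open>8/5 + 1\<close> for
  \<open>p^2 = p + 1\<close>. The same identity balances the quadratic terms in the second
  inequality, and \<open>p <= 2\<close> leaves enough linear slack. That inequality is the form used
  in \<open>excess_base_outside\<close>.\<close>

lemma golden_ratio_gap:
  fixes n r :: nat
  assumes "3 \<le> r" "((1 + sqrt 5) / 2)\<^sup>2 * real r < real n"
  shows "13 * r \<le> 5 * n" "(n - 4) * (r - 2) \<le> (n - r - 1) * (n - r - 2)"
proof -
  define p a R where "p = (1 + sqrt 5) / 2" and "a = real n - real r" and "R = real r"
  have p2: "p\<^sup>2 = p + 1"
    by (simp add: p_def power2_eq_square field_simps)
  have "(8/5 :: real) \<le> p" "p \<le> 2"
    using real_le_rsqrt[of "11/5" 5] real_le_lsqrt[of 3 5]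
    by (auto simp: p_def power2_eq_square)
  have R: "3 \<le> R" using assms by (simp add: R_def)
  have a: "p * R \<le> a" using assms(2) p2 by (simp add: p_def[symmetric] a_def R_def algebra_simps)
  have "8 / 5 * R \<le> p * R" using \<open>8 / 5 \<le> p\<close> R by (intro mult_right_mono) auto
  then have aR: "8 / 5 * R \<le> a" using a by simp
  then show *: "13 * r \<le> 5 * n" by (simp add: a_def R_def)
  have "p * R * (p * R - R - 1) \<le> a * (a - R - 1)"
  proof (intro mult_mono)
    show "p * R \<le> a" "p * R - R - 1 \<le> a - R - 1" "0 \<le> a" "0 \<le> p * R - R - 1"
      using a aR R \<open>8 / 5 * R \<le> p * R\<close> by linarith+
  qed
  moreover have "p * R * (p * R - R - 1) = R\<^sup>2 - p * R"
  proof -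
    have "p * R * (p * R - R - 1) = p\<^sup>2 * R\<^sup>2 - p * R\<^sup>2 - p * R"
      by (simp add: power2_eq_square algebra_simps)
    then show ?thesis by (simp add: p2 algebra_simps)
  qed
  moreover have "p * R \<le> 2 * R" using \<open>p \<le> 2\<close> R by (intro mult_right_mono) auto
  ultimately have "R\<^sup>2 - 2 * R \<le> a * (a - R - 1)" by linarith
  then have "(a + R - 4) * (R - 2) \<le> (a - 1) * (a - 2)"
    using R by (simp add: power2_eq_square algebra_simps)
  moreover have "real (n - 4) = a + R - 4" "real (r - 2) = R - 2"
    "real (n - r - 1) = a - 1" "real (n - r - 2) = a - 2"
    using * assms(1) by (simp_all add: a_def R_def of_nat_diff)
  ultimately show "(n - 4) * (r - 2) \<le> (n - r - 1) * (n - r - 2)"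
    by (metis of_nat_le_iff of_nat_mult)
qed

text \<open>Two rounds of Pascal's rule reduce the claim to
  \<open>Suc N choose k <= N choose Suc k\<close>. The right side is the left side times
  \<open>(N - k + 1) * (N - k) / (Suc N * Suc k)\<close>, and the third assumption says that this
  factor is at least 1.\<close>

lemma excess_base_outside:
  fixes n r :: nat
  assumes "3 \<le> r" "13 * r \<le> 5 * n" "(n - 4) * (r - 2) \<le> (n - r - 1) * (n - r - 2)"
  shows "excess 1 1 (n - 3 - 2) r \<le> excess 1 2 (n - 3) r"
proof -
  define N k where "N = n - 5" and "k = r - 3"
  have n: "n = N + 5" "r = k + 3" "k + 2 < N" using assms by (auto simp: N_def k_def)
  have le: "Suc N * Suc k \<le> (N - k + 1) * (N - k)"
    using assms(3) n by (simp add: Suc_diff_le)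
  have "Suc N choose k \<le> N choose Suc k"
  proof -
    have "Suc k * (Suc N choose Suc k) = (N - k + 1) * (Suc N choose k)"
      using Suc_times_choose_Suc[of k "Suc N"] n by (simp add: Suc_diff_le del: binomial_Suc_Suc)
    then have "(N - k + 1) * (N - k) * (Suc N choose k) = (N - k) * (Suc k * (Suc N choose Suc k))"
      by (simp only: mult_ac)
    also have "\<dots> = Suc k * (Suc N * (N choose Suc k))"
      using binomial_absorb_comp[of "Suc N" "Suc k"]
      by (simp only: diff_Suc_Suc diff_Suc_1 mult.left_commute)
    also have "\<dots> = Suc N * Suc k * (N choose Suc k)" by (simp only: mult_ac)
    also have "\<dots> \<le> (N - k + 1) * (N - k) * (N choose Suc k)"
      using le by (intro mult_right_mono) auto
    finally show ?thesis
      using n by (elim mult_left_le_imp_le) auto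
  qed
  then show ?thesis
    using n by (simp add: excess_def shifted_choose_def numeral_2_eq_2 numeral_3_eq_3)
qed

subsection \<open>Compressed families\<close>

text \<open>The positions with entry at most \<open>c\<close> form an initial segment of the sorted
  list. This turns comparisons of listings into comparisons of counts.\<close>

lemma nth_sorted_list_of_set_le_iff:
  fixes A :: "nat set"
  assumes "finite A" "i < card A"
  shows "sorted_list_of_set A ! i \<le> c \<longleftrightarrow> i < card (A \<inter> {..c})"
proof -
  define xs where "xs = sorted_list_of_set A"
  define S where "S = {j. j < length xs \<and> xs ! j \<le> c}"
  have xs: "sorted xs" "distinct xs" "set xs = A" "length xs = card A"
    using assms by (auto simp: xs_def)
  have "A \<inter> {..c} = (!) xs ` S"
    unfolding xs(3)[symmetric] S_def by (auto simp: in_set_conv_nth)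
  moreover have "inj_on ((!) xs) S"
    using xs(2) by (auto simp: inj_on_def S_def nth_eq_iff_index_eq)
  ultimately have card: "card (A \<inter> {..c}) = card S"
    by (simp add: card_image)
  have "finite S" by (simp add: S_def)
  show ?thesis
  proof (cases "xs ! i \<le> c")
    case True
    then have "{..i} \<subseteq> S"
      using xs assms sorted_nth_mono[of xs _ i] by (fastforce simp: S_def)
    then have "card {..i} \<le> card S" using \<open>finite S\<close> by (rule card_mono[rotated])
    then show ?thesis using True card by (simp add: xs_def)
  next
    case False
    have "S \<subseteq> {..<i}"
    proof
      fix j assume "j \<in> S"
      then show "j \<in> {..<i}"
        using False xs sorted_nth_mono[of xs i j] by (cases "i \<le> j") (auto simp: S_def)
    qed
    then have "card S \<le> card {..<i}" by (intro card_mono) auto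
    then show ?thesis using False card by (simp add: xs_def)
  qed
qed

lemma prec_iff_card_le:
  assumes "finite A" "finite C"
  shows "prec A C \<longleftrightarrow> (\<forall>c. card (C \<inter> {..c}) \<le> card (A \<inter> {..c}))"
proof
  assume *: "prec A C"
  show "\<forall>c. card (C \<inter> {..c}) \<le> card (A \<inter> {..c})"
  proof
    fix c
    show "card (C \<inter> {..c}) \<le> card (A \<inter> {..c})"
    proof (cases "card (C \<inter> {..c})")
      case (Suc i)
      have "card (C \<inter> {..c}) \<le> card C" using assms by (intro card_mono) auto
      then have i: "i < card C" "i < card A" using * Suc by (auto simp: prec_def)
      then have "sorted_list_of_set C ! i \<le> c"
        using nth_sorted_list_of_set_le_iff[OF assms(2) i(1)] Suc by auto
      moreover have "sorted_list_of_set A ! i \<le> sorted_list_of_set C ! i"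
        using * i by (simp add: prec_def)
      ultimately show ?thesis
        using nth_sorted_list_of_set_le_iff[OF assms(1) i(2), of c] Suc by auto
    qed simp
  qed
next
  assume *: "\<forall>c. card (C \<inter> {..c}) \<le> card (A \<inter> {..c})"
  \<comment> \<open>A common upper bound of both sets yields the cardinality condition;
    \<open>c\<close> equal to an entry of \<open>C\<close> yields the inequality at that
    entry.\<close>
  obtain m where "A \<union> C \<subseteq> {..m}"
    using assms finite_nat_set_iff_bounded_le[of "A \<union> C"] by auto
  then have card: "card C \<le> card A" using *[rule_format, of m] by (simp add: Int_absorb2)
  show "prec A C"
    unfolding prec_def
  proof (intro conjI allI impI card)
    fix i assume i: "i < card C"
    then have "i < card (C \<inter> {..sorted_list_of_set C ! i})"
      using nth_sorted_list_of_set_le_iff[OF assms(2) i] by blast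
    also have "\<dots> \<le> card (A \<inter> {..sorted_list_of_set C ! i})" using * by blast
    finally show "sorted_list_of_set A ! i \<le> sorted_list_of_set C ! i"
      using nth_sorted_list_of_set_le_iff[OF assms(1)] i card by simp
  qed
qed

lemma compression_le_iff_card_le:
  assumes "A \<in> nsets S r" "B \<in> nsets T r"
  shows "compression_le A B \<longleftrightarrow> (\<forall>c. card (B \<inter> {..c}) \<le> card (A \<inter> {..c}))"
  using assms prec_iff_card_le[of A B] by (auto simp: nsets_def compression_le_def prec_def)

text \<open>These are Frankl's families; \<open>i = 1\<close> gives the star. Members lie in
  \<open>{1..n}\<close>, so \<open>{..2 * i - 1}\<close> cuts out the same points as
  \<open>[2i-1]\<close> for \<open>i >= 1\<close>.\<close>

definition threshold_family :: "nat \<Rightarrow> nat \<Rightarrow> nat \<Rightarrow> nat set set" where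
  "threshold_family n r i = {A \<in> nsets {1..n} r. i \<le> card (A \<inter> {..2 * i - 1})}"

lemma compressed_threshold_family: "compressed n r (threshold_family n r i)"
  unfolding compressed_def
proof (intro conjI ballI impI)
  show "threshold_family n r i \<subseteq> nsets {1..n} r" by (auto simp: threshold_family_def)
next
  fix A B assume A: "A \<in> threshold_family n r i" and B: "B \<in> nsets {1..n} r" "compression_le B A"
  then have "card (A \<inter> {..2 * i - 1}) \<le> card (B \<inter> {..2 * i - 1})"
    using compression_le_iff_card_le[of B "{1..n}" r A "{1..n}"] by (simp add: threshold_family_def)
  then show "B \<in> threshold_family n r i"
    using A B(1) by (auto simp: threshold_family_def)
qed

text \<open>Two disjoint members would need \<open>2 * i\<close> points of
  \<open>[2i-1]\<close>.\<close>

lemma intersecting_threshold_family: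
  assumes "1 \<le> i"
  shows "intersecting (threshold_family n r i)"
  unfolding intersecting_def
proof (intro ballI notI)
  fix A B assume AB: "A \<in> threshold_family n r i" "B \<in> threshold_family n r i" "A \<inter> B = {}"
  let ?c = "2 * i - 1"
  have "card (A \<inter> {..?c}) + card (B \<inter> {..?c}) = card ((A \<inter> {..?c}) \<union> (B \<inter> {..?c}))"
    using AB by (intro card_Un_disjoint[symmetric]) auto
  also have "\<dots> \<le> card {1..?c}"
    using AB by (intro card_mono) (auto simp: threshold_family_def nsets_def)
  finally show False
    using AB assms by (auto simp: threshold_family_def)
qed

lemma generated_family_subset_threshold:
  assumes "2 * r \<le> n" "finite G" "intersecting (generated_family r n {G})"
    and "generated_family r n {G} \<noteq> {}"
  obtains i where "1 \<le> i" "i \<le> r" "generated_family r n {G} \<subseteq> threshold_family n r i"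
proof -
  \<comment> \<open>Nonemptiness enters here: a member \<open>A\<close> satisfies
    \<open>prec A G\<close>, so it has at least \<open>card G\<close> elements.\<close>
  have "card G \<le> r"
    using assms(4) by (auto simp: generated_family_def prec_def nsets_def)
  have "\<exists>i\<in>{1..r}. i \<le> card (G \<inter> {..2 * i - 1})"
  proof (rule ccontr)
    assume no: "\<not> ?thesis"
    \<comment> \<open>Both sets have at least \<open>min r (c div 2)\<close> elements up to every
      \<open>c\<close>, and by \<open>count\<close> below \<open>G\<close> has at most that many, so
      both precede \<open>G\<close>.\<close>
    define E O' where "E = (\<lambda>k. 2 * k) ` {1..r}" and "O' = (\<lambda>k. 2 * k - 1) ` {1..r}"
    have count: "card (G \<inter> {..c}) \<le> min r (c div 2)" for c
    proof -
      have "card (G \<inter> {..c}) \<le> card G" using assms by (intro card_mono) auto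
      moreover have "card (G \<inter> {..c}) < c div 2 + 1" if "c div 2 < r"
      proof -
        have "card (G \<inter> {..c}) \<le> card (G \<inter> {..2 * (c div 2 + 1) - 1})"
          using assms by (intro card_mono) auto
        moreover have "c div 2 + 1 \<in> {1..r}" using that by auto
        then have "card (G \<inter> {..2 * (c div 2 + 1) - 1}) < c div 2 + 1" using no by (meson not_le)
        ultimately show ?thesis by linarith
      qed
      ultimately show ?thesis using \<open>card G \<le> r\<close> by linarith
    qed
    have inj: "inj_on (\<lambda>k. 2 * k) {1..r}" "inj_on (\<lambda>k. 2 * k - 1 :: nat) {1..r}"
      by (auto simp: inj_on_def)
    have E: "min r (c div 2) \<le> card (E \<inter> {..c})" for c
    proof -
      have "card ((\<lambda>k. 2 * k) ` {1..min r (c div 2)}) \<le> card (E \<inter> {..c})"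
        by (intro card_mono) (auto simp: E_def)
      then show ?thesis using inj by (simp add: card_image inj_on_def)
    qed
    have O': "min r (c div 2) \<le> card (O' \<inter> {..c})" for c
    proof -
      have "inj_on (\<lambda>k. 2 * k - 1) {1..min r (c div 2)}" by (rule inj_on_subset[OF inj(2)]) auto
      then have "min r (c div 2) = card ((\<lambda>k. 2 * k - 1) ` {1..min r (c div 2)})"
        by (simp add: card_image)
      also have "\<dots> \<le> card (O' \<inter> {..c})"
        by (intro card_mono) (auto simp: O'_def)
      finally show ?thesis .
    qed
    have "finite E" "finite O'" by (auto simp: E_def O'_def)
    then have "prec E G" "prec O' G"
      using le_trans[OF count E] le_trans[OF count O'] assms(2) by (simp_all add: prec_iff_card_le)
    moreover have "E \<in> nsets {1..n} r" "O' \<in> nsets {1..n} r"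
      using inj assms(1) by (auto simp: nsets_def E_def O'_def card_image)
    ultimately have "E \<inter> O' \<noteq> {}"
      using assms(3) by (auto simp: intersecting_def generated_family_def)
    then show False by (auto simp: E_def O'_def) presburger
  qed
  then obtain i where i: "1 \<le> i" "i \<le> r" "i \<le> card (G \<inter> {..2 * i - 1})" by auto
  have "generated_family r n {G} \<subseteq> threshold_family n r i"
    using i(3) prec_iff_card_le[OF _ assms(2)]
    by (auto simp: generated_family_def threshold_family_def nsets_def intro: order_trans)
  then show ?thesis using that i by blast
qed

subsection \<open>Counting\<close>

lemma card_subsets_Un:
  assumes "finite V" "finite W" "V \<inter> W = {}" "finite K"
  shows "card {A. A \<subseteq> V \<union> W \<and> card A = r \<and> card (A \<inter> V) \<in> K}
    = (\<Sum>k\<in>K. (card V choose k) * shifted_choose (card W) r k)"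
proof -
  define S where "S k = {A. A \<subseteq> V \<union> W \<and> card A = r \<and> card (A \<inter> V) = k}" for k
  have fin: "finite (S k)" for k
    by (rule finite_subset[of _ "Pow (V \<union> W)"]) (use assms in \<open>auto simp: S_def\<close>)
  have card_split: "card A = card (A \<inter> V) + card (A \<inter> W)" if "A \<subseteq> V \<union> W" for A
  proof -
    have "card ((A \<inter> V) \<union> (A \<inter> W)) = card (A \<inter> V) + card (A \<inter> W)"
      using assms by (intro card_Un_disjoint) auto
    moreover have "(A \<inter> V) \<union> (A \<inter> W) = A" using that by auto
    ultimately show ?thesis by simp
  qed
  have card_S: "card (S k) = (card V choose k) * shifted_choose (card W) r k" for k
  proof (cases "k \<le> r")
    case True
    have "bij_betw (\<lambda>A. (A \<inter> V, A \<inter> W)) (S k)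
        ({P. P \<subseteq> V \<and> card P = k} \<times> {Q. Q \<subseteq> W \<and> card Q = r - k})"
    proof (rule bij_betw_byWitness[where f' = "\<lambda>(P, Q). P \<union> Q"])
      show "\<forall>A\<in>S k. (case (A \<inter> V, A \<inter> W) of (P, Q) \<Rightarrow> P \<union> Q) = A"
        by (auto simp: S_def)
      show "\<forall>p\<in>{P. P \<subseteq> V \<and> card P = k} \<times> {Q. Q \<subseteq> W \<and> card Q = r - k}.
          ((case p of (P, Q) \<Rightarrow> P \<union> Q) \<inter> V, (case p of (P, Q) \<Rightarrow> P \<union> Q) \<inter> W) = p"
        using assms(3) by auto
      show "(\<lambda>A. (A \<inter> V, A \<inter> W)) ` S k
          \<subseteq> {P. P \<subseteq> V \<and> card P = k} \<times> {Q. Q \<subseteq> W \<and> card Q = r - k}"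
        using card_split by (auto simp: S_def)
      show "(\<lambda>(P, Q). P \<union> Q) `
          ({P. P \<subseteq> V \<and> card P = k} \<times> {Q. Q \<subseteq> W \<and> card Q = r - k}) \<subseteq> S k"
      proof clarify
        fix P Q assume "P \<subseteq> V" "Q \<subseteq> W" "card Q = r - card P" "k = card P"
        moreover from this have "(P \<union> Q) \<inter> V = P" "(P \<union> Q) \<inter> W = Q" using assms(3) by auto
        ultimately show "P \<union> Q \<in> S (card P)"
          using card_split[of "P \<union> Q"] True by (auto simp: S_def)
      qed
    qed
    then have "card (S k) = card ({P. P \<subseteq> V \<and> card P = k} \<times> {Q. Q \<subseteq> W \<and> card Q = r - k})"
      by (rule bij_betw_same_card)
    then show ?thesis
      using True assms by (simp add: card_cartesian_product n_subsets shifted_choose_def)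
  next
    case False
    then have "S k = {}" using card_split by (auto simp: S_def)
    then show ?thesis using False by (simp add: shifted_choose_def)
  qed
  have "{A. A \<subseteq> V \<union> W \<and> card A = r \<and> card (A \<inter> V) \<in> K} = (\<Union>k\<in>K. S k)"
    by (auto simp: S_def)
  also have "card \<dots> = (\<Sum>k\<in>K. card (S k))"
    using assms fin by (intro card_UN_disjoint) (auto simp: S_def)
  finally show ?thesis by (simp add: card_S)
qed

lemma finite_star: "finite (star n r)"
  by (simp add: star_def finite_imp_finite_nsets)

lemma finite_threshold_family: "finite (threshold_family n r i)"
  by (simp add: threshold_family_def finite_imp_finite_nsets)

text \<open>Sets that miss \<open>X\<close> live on a smaller ground set, which makes them countable
  by binomial sums. Common members cancel; what remains is \<open>S - T\<close>, counted by
  \<open>P\<close> after removing the point 1, and \<open>T - S = Q\<close>.\<close>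

lemma card_missing_diff:
  assumes "u < r" "2 * u + 1 \<le> n" "X \<subseteq> {2..n}"
  shows "real (card {A \<in> star n r. A \<inter> X = {}})
       - real (card {A \<in> threshold_family n r (Suc u). A \<inter> X = {}})
       = excess u (card ({2..2 * u + 1} - X)) (card ({2 * u + 2..n} - X)) r"
proof -
  define V W where "V = {2..2 * u + 1} - X" and "W = {2 * u + 2..n} - X"
  define P where "P = {A. A \<subseteq> V \<union> W \<and> card A = r - 1 \<and> card (A \<inter> V) \<in> {..<u}}"
  define Q where "Q = {A. A \<subseteq> V \<union> W \<and> card A = r \<and> card (A \<inter> V) \<in> {u<..2 * u}}"
  define S T where "S = {A \<in> star n r. A \<inter> X = {}}"
    and "T = {A \<in> threshold_family n r (Suc u). A \<inter> X = {}}"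
  have fin: "finite V" "finite W" "V \<inter> W = {}" by (auto simp: V_def W_def)
  have VW: "V \<union> W = {2..n} - X" using assms by (auto simp: V_def W_def)
  have "card V \<le> card {2..2 * u + 1}" by (intro card_mono) (auto simp: V_def)
  then have card_V: "card V \<le> 2 * u" by simp
  have init: "A \<inter> {..2 * Suc u - 1} = A \<inter> V" if "A \<subseteq> {2..n} - X" for A
    using that by (auto simp: V_def)
  have init1: "insert 1 A \<inter> {..2 * Suc u - 1} = insert 1 (A \<inter> V)" if "A \<subseteq> {2..n} - X" for A
    using that by (auto simp: V_def)
  have notin1: "1 \<notin> A" if "A \<subseteq> {2..n} - X" for A using that by auto
  have "S - T = insert 1 ` P"
  proof (intro equalityI subsetI)
    fix A assume A: "A \<in> S - T"
    define A' where "A' = A - {1}"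
    have A': "A = insert 1 A'" "A' \<subseteq> {2..n} - X" "card A' = r - 1" "finite A'" "card A = r"
      using A by (auto simp: S_def star_def nsets_def A'_def)
    have "A \<notin> threshold_family n r (Suc u)" "A \<in> nsets {1..n} r"
      using A by (auto simp: S_def T_def star_def)
    then have "card (insert 1 (A' \<inter> V)) < Suc u"
      using init1[OF A'(2)] A'(1) by (auto simp: threshold_family_def)
    then have "card (A' \<inter> V) < u" using notin1[OF A'(2)] A'(4) by simp
    then show "A \<in> insert 1 ` P" using A' VW by (auto simp: P_def)
  next
    fix A assume "A \<in> insert 1 ` P"
    then obtain A' where A': "A = insert 1 A'" "A' \<subseteq> {2..n} - X" "card A' = r - 1"
      "card (A' \<inter> V) < u" using VW by (auto simp: P_def)
    have "finite A'" using A'(2) by (rule finite_subset) auto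
    moreover have "1 \<le> n" "1 \<notin> X" using assms by auto
    ultimately have "A \<in> S"
      using A' notin1[OF A'(2)] assms by (auto simp: S_def star_def nsets_def)
    moreover have "card (A \<inter> {..2 * Suc u - 1}) < Suc u"
      unfolding A'(1) init1[OF A'(2)] using A' notin1[OF A'(2)] \<open>finite A'\<close> by simp
    ultimately show "A \<in> S - T" by (auto simp: T_def threshold_family_def)
  qed
  moreover have "inj_on (insert 1) P"
    using notin1 VW by (auto simp: inj_on_def P_def insert_ident)
  ultimately have "card (S - T) = card P" by (simp add: card_image)
  also have "\<dots> = (\<Sum>k<u. (card V choose k) * shifted_choose (card W) (r - 1) k)"
    unfolding P_def by (rule card_subsets_Un) (use fin in auto)
  also have "\<dots> = (\<Sum>k<u. (card V choose k) * shifted_choose (card W) r (Suc k))"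
    using assms(1) by (cases r) (auto simp: shifted_choose_Suc_Suc)
  finally have ST: "card (S - T) = \<dots>" .
  have "T - S = Q"
  proof (intro equalityI subsetI)
    fix A assume A: "A \<in> T - S"
    then have A': "A \<in> nsets {1..n} r" "Suc u \<le> card (A \<inter> {..2 * Suc u - 1})" "A \<inter> X = {}" "1 \<notin> A"
      by (auto simp: S_def T_def star_def threshold_family_def)
    have sub: "A \<subseteq> {2..n} - X"
    proof
      fix x assume "x \<in> A"
      then have "x \<in> {1..n}" "x \<noteq> 1" "x \<notin> X" using A' by (auto simp: nsets_def)
      then show "x \<in> {2..n} - X" by auto
    qed
    have "card (A \<inter> V) \<le> 2 * u"
      using card_mono[of V "A \<inter> V"] fin card_V by simp
    then show "A \<in> Q" using A' sub init[OF sub] VW by (auto simp: Q_def nsets_def)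
  next
    fix A assume "A \<in> Q"
    then have sub: "A \<subseteq> {2..n} - X" and A: "card A = r" "u < card (A \<inter> V)"
      using VW by (auto simp: Q_def)
    have "finite A" using sub by (rule finite_subset) auto
    then show "A \<in> T - S"
      using A sub init[OF sub] notin1[OF sub]
      by (auto simp: S_def T_def star_def threshold_family_def nsets_def)
  qed
  then have "card (T - S) = (\<Sum>k\<in>{u<..2 * u}. (card V choose k) * shifted_choose (card W) r k)"
    unfolding Q_def using card_subsets_Un[OF fin, of "{u<..2 * u}"] by simp
  \<comment> \<open>Reflection at \<open>u\<close> aligns the intersection sizes above
    \<open>u\<close> with those below, as in \<open>excess\<close>.\<close>
  also have "\<dots> = (\<Sum>k<u. (card V choose (2 * u - k)) * shifted_choose (card W) r (2 * u - k))"
    by (rule sum.reindex_bij_witness[of _ "\<lambda>k. 2 * u - k" "\<lambda>k. 2 * u - k"]) auto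
  finally have TS: "card (T - S) = \<dots>" .
  have "finite S" "finite T"
    by (auto simp: S_def T_def finite_star finite_threshold_family)
  then have "card S = card (S \<inter> T) + card (S - T)" "card T = card (S \<inter> T) + card (T - S)"
    by (metis card_Int_Diff inf_commute)+
  then have diff: "real (card S) - real (card T) = real (card (S - T)) - real (card (T - S))"
    by simp
  have "real (card S) - real (card T) = excess u (card V) (card W) r"
    unfolding diff ST TS excess_def by (simp add: sum_subtractf)
  then show ?thesis unfolding S_def T_def V_def W_def .
qed

text \<open>Hitting sets are all sets less the missing ones, so \<open>card_missing_diff\<close> is
  applied to \<open>X\<close> and to the empty set.\<close>

lemma card_hitting_diff:
  assumes "u < r" "2 * u + 1 \<le> n" "X \<subseteq> {2..n}"
  shows "real (card (hitting (star n r) X)) - real (card (hitting (threshold_family n r (Suc u)) X))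
       = excess u (2 * u) (n - 1 - 2 * u) r
         - excess u (2 * u - card (X \<inter> {2..2 * u + 1}))
             (n - 1 - 2 * u - card (X \<inter> {2 * u + 2..n})) r"
proof -
  have split: "real (card (hitting F X)) = real (card {A \<in> F. A \<inter> {} = {}}) - real (card {A \<in> F. A \<inter> X = {}})"
    if "finite F" for F
  proof -
    have "hitting F X \<union> {A \<in> F. A \<inter> X = {}} = {A \<in> F. A \<inter> {} = {}}" by (auto simp: hitting_def)
    moreover have "card (hitting F X \<union> {A \<in> F. A \<inter> X = {}})
        = card (hitting F X) + card {A \<in> F. A \<inter> X = {}}"
      using that by (intro card_Un_disjoint) (auto simp: hitting_def)
    ultimately show ?thesis by simp
  qed
  have "card ({2..2 * u + 1} - X) = 2 * u - card (X \<inter> {2..2 * u + 1})"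
    "card ({2 * u + 2..n} - X) = n - 1 - 2 * u - card (X \<inter> {2 * u + 2..n})"
    by (simp_all add: card_Diff_subset_Int Int_commute)
  then show ?thesis
    using card_missing_diff[OF assms] card_missing_diff[OF assms(1,2), of "{}"]
      split[OF finite_star] split[OF finite_threshold_family]
    by simp
qed

subsection \<open>Necessary conditions for eventual EKR\<close>

lemma eventually_EKR_not_subset:
  assumes "2 \<le> r" "eventually_EKR r X" "X \<noteq> {}"
  shows "\<not> X \<subseteq> {2..r + 1}"
proof
  assume X: "X \<subseteq> {2..r + 1}"
  obtain n where n: "r + 1 \<le> n" "EKR n r X"
  proof -
    have "\<forall>\<^sub>F n in sequentially. r + 1 \<le> n \<and> EKR n r X"
      using assms(2) eventually_ge_at_top by (auto simp: eventually_EKR_def intro: eventually_conj)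
    then show ?thesis using that eventually_happens'[OF sequentially_bot] by blast
  qed
  define B where "B = {2..r + 1}"
  \<comment> \<open>a Hilton--Milner family: it contains every member of the star that hits \<open>X\<close>, and \<open>B\<close> as well\<close>
  define F where "F = insert B {A \<in> nsets {1..n} r. 1 \<in> A \<and> A \<inter> B \<noteq> {}}"
  have B: "B \<in> nsets {1..n} r" "1 \<notin> B" "B \<noteq> {}"
    using n assms(1) by (auto simp: B_def nsets_def)
  have "intersecting F"
    using B by (auto simp: intersecting_def F_def)
  moreover have "compressed n r F"
    unfolding compressed_def
  proof (intro conjI ballI impI)
    show "F \<subseteq> nsets {1..n} r" using B by (auto simp: F_def)
  next
    fix A C assume A: "A \<in> F" and C: "C \<in> nsets {1..n} r" and "compression_le C A"
    then have le: "card (A \<inter> {..c}) \<le> card (C \<inter> {..c})" for c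
      using compression_le_iff_card_le[OF C, of A "{1..n}"] B by (auto simp: F_def)
    have C': "C \<subseteq> {1..n}" "card C = r" "finite C" using C by (auto simp: nsets_def)
    \<comment> \<open>Compression only controls counts in initial segments. Two elements in
      \<open>[r+1]\<close>, one of them 1, provide an element of \<open>B\<close>.\<close>
    have hit: "C \<in> F" if "1 \<in> C" "2 \<le> card (C \<inter> {..r + 1})"
    proof -
      have "\<not> C \<inter> {..r + 1} \<subseteq> {1}"
        using that card_mono[of "{1}" "C \<inter> {..r + 1}"] by auto
      then have "C \<inter> B \<noteq> {}" using C' by (force simp: B_def)
      then show ?thesis using that C by (simp add: F_def)
    qed
    show "C \<in> F"
    proof (cases "1 \<in> A")
      case True
      then have "A \<inter> B \<noteq> {}" using A B by (auto simp: F_def)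
      then obtain b where "b \<in> A" "b \<in> B" by auto
      have "card {1::nat} \<le> card (A \<inter> {..1})" using True by (intro card_mono) auto
      then have "C \<inter> {..1} \<noteq> {}" using le[of 1] by auto
      then have "1 \<in> C" using C' by (force simp: le_Suc_eq)
      moreover have "card {1, b} \<le> card (A \<inter> {..r + 1})"
        using True \<open>b \<in> A\<close> \<open>b \<in> B\<close> by (intro card_mono) (auto simp: B_def)
      then have "2 \<le> card (C \<inter> {..r + 1})" using le[of "r + 1"] \<open>b \<in> B\<close> by (auto simp: B_def)
      ultimately show ?thesis by (rule hit)
    next
      case False
      then have "A \<inter> {..r + 1} = B" using A by (auto simp: F_def B_def)
      then have r: "r \<le> card (C \<inter> {..r + 1})" using le[of "r + 1"] by (simp add: B_def)
      show ?thesis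
      proof (cases "1 \<in> C")
        case True
        then show ?thesis using r assms(1) by (intro hit) auto
      next
        case False
        \<comment> \<open>All \<open>r\<close> elements of \<open>C\<close> lie in
          \<open>[r+1]\<close> and none is 1, which leaves only \<open>B\<close>.\<close>
        have "C \<inter> {..r + 1} = C"
          using r C' by (intro card_subset_eq) (auto intro: antisym card_mono)
        then have "C \<subseteq> {..r + 1}" by blast
        then have "C \<subseteq> B" using C' False by (force simp: B_def Suc_le_eq le_less)
        then have "C = B" using C' by (intro card_subset_eq) (auto simp: B_def)
        then show ?thesis by (simp add: F_def)
      qed
    qed
  qed
  ultimately have "card (hitting F X) \<le> card (hitting (star n r) X)"
    using n(2) by (simp add: EKR_def)
  moreover have "hitting (star n r) X \<subset> hitting F X"
  proof
    show "hitting (star n r) X \<subseteq> hitting F X"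
      using X by (auto simp: hitting_def star_def F_def B_def)
    have "B \<in> hitting F X" "B \<notin> hitting (star n r) X"
      using X assms(3) B by (auto simp: hitting_def star_def F_def B_def)
    then show "hitting (star n r) X \<noteq> hitting F X" by blast
  qed
  moreover have "finite (hitting F X)"
    by (simp add: hitting_def F_def finite_imp_finite_nsets)
  ultimately show False using psubset_card_mono by (metis not_le)
qed

text \<open>Otherwise \<open>card_hitting_diff\<close> with \<open>u = 1\<close> turns the EKR
  inequality for \<open>threshold_family n r 2\<close> into the claim that a positive binomial
  coefficient is at most 0. A single \<open>n >= r + 3\<close> gives this contradiction.\<close>

lemma eventually_EKR_card_ge:
  assumes "3 \<le> r" "eventually_EKR r X" "X \<inter> {2, 3} \<noteq> {}"
  shows "2 \<le> card (X - {2, 3})"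
proof (rule ccontr)
  assume small: "\<not> ?thesis"
  obtain n where n: "r + 3 \<le> n" "EKR n r X"
  proof -
    have "\<forall>\<^sub>F n in sequentially. r + 3 \<le> n \<and> EKR n r X"
      using assms(2) eventually_ge_at_top by (auto simp: eventually_EKR_def intro: eventually_conj)
    then show ?thesis using that eventually_happens'[OF sequentially_bot] by blast
  qed
  have X: "X \<subseteq> {2..n}" "finite X" using n assms by (auto simp: EKR_def eventually_EKR_def)
  define b m where "b = 2 - card (X \<inter> {2..3})" and "m = card (X \<inter> {4..n})"
  have "{2..3} = {2, 3::nat}" by auto
  then have "card (X \<inter> {2..3}) \<noteq> 0" using assms(3) by simp
  then have b: "b \<le> 1" unfolding b_def by linarith
  have "X \<inter> {4..n} \<subseteq> X - {2, 3}" by auto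
  then have "m \<le> card (X - {2, 3})" unfolding m_def using X by (intro card_mono) auto
  then have m: "m \<le> 1" using small by simp
  have "card (hitting (threshold_family n r (Suc 1)) X) \<le> card (hitting (star n r) X)"
    using n(2) compressed_threshold_family intersecting_threshold_family by (simp add: EKR_def)
  moreover have "real (card (hitting (star n r) X))
      - real (card (hitting (threshold_family n r (Suc 1)) X))
      = excess 1 2 (n - 3) r - excess 1 b (n - 3 - m) r"
  proof -
    have "(1::nat) < r" "2 * 1 + 1 \<le> n" "n - 1 - 2 * 1 = n - 3" "2 * (1::nat) + 1 = 3"
      "2 * (1::nat) + 2 = 4" "2 * (1::nat) = 2"
      using assms n by auto
    then show ?thesis
      using card_hitting_diff[of 1 r n X] X(1) unfolding b_def m_def by metis
  qed
  ultimately have le: "excess 1 b (n - 3 - m) r \<le> excess 1 2 (n - 3) r" by linarith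
  obtain q where q: "r = q + 3" using assms(1) by (metis le_add_diff_inverse2)
  have "q + 6 \<le> n" using n(1) q by simp
  then obtain N where N: "n = q + 6 + N" using le_Suc_ex by blast
  define L where "L = q + 2 + N"
  have L: "n - 3 = Suc L" "q + 1 \<le> L" using N by (auto simp: L_def)
  have full: "excess 1 2 (Suc L) r = real (Suc L choose (q + 2)) - real (Suc L choose (q + 1))"
    unfolding excess_def shifted_choose_def q by simp
  \<comment> \<open>With \<open>b <= 1\<close> the negative part vanishes, since
    \<open>b choose 2 = 0\<close>.\<close>
  have rest: "excess 1 b K r = real (K choose (q + 2))" for K
    using b unfolding excess_def shifted_choose_def q by (auto simp: binomial_eq_0)
  consider "m = 0" | "m = 1" using m by linarith
  then show False
  proof cases
    case 1
    then have "real (Suc L choose (q + 1)) \<le> 0" using le unfolding full rest L by simp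
    then show False using L(2) by (simp del: binomial_Suc_Suc add: not_less)
  next
    case 2
    then have "real (L choose q) \<le> 0" using le unfolding full rest L by simp
    then show False using L(2) by simp
  qed
qed

section \<open>Choice of the base set and the final comparison\<close>

theorem theorem5:
  fixes r n :: nat and G X :: "nat set"
  assumes "r \<ge> 3"
    and "real n > ((1 + sqrt 5) / 2)\<^sup>2 * real r"
    and "G \<subseteq> {1..n}"
    and "intersecting (generated_family r n {G})"
    and "X \<subseteq> {2..n}"
    and "eventually_EKR r X"
  shows "card (hitting (generated_family r n {G}) X) \<le> card (hitting (star n r) X)"
proof (cases "generated_family r n {G} = {} \<or> X = {}")
  case True
  then show ?thesis by (auto simp: hitting_def)
next
  case False
  note nr = golden_ratio_gap[OF assms(1,2)]
  \<comment> \<open>The slack 2 pays for the outside points of the base set, at most two, in the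
    last condition of \<open>excess_extend\<close>.\<close>
  have n: "2 * r + 2 \<le> n" using nr(1) assms(1) by linarith
  obtain i where i: "1 \<le> i" "i \<le> r" "generated_family r n {G} \<subseteq> threshold_family n r i"
    using generated_family_subset_threshold[of r n G] n assms(3,4) False
    by (metis add_leD1 finite_atLeastAtMost finite_subset)
  define u where "u = i - 1"
  have u: "i = Suc u" "u < r" "2 * u + 1 \<le> n" using i n by (auto simp: u_def)
  define M t m where "M = n - 1 - 2 * u" and "t = card (X \<inter> {2..2 * u + 1})"
    and "m = card (X \<inter> {2 * u + 2..n})"
  have "t \<le> card {2..2 * u + 1}" unfolding t_def by (intro card_mono) auto
  then have t: "t \<le> 2 * u" by simp
  have "m \<le> card {2 * u + 2..n}" unfolding m_def by (intro card_mono) auto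
  then have m: "m \<le> M" by (simp add: M_def)
  \<comment> \<open>The pair \<open>(t0, m0)\<close> is \<open>(0, 0)\<close> if
    \<open>t = 0\<close>; otherwise it is \<open>(1, 2)\<close> if \<open>u = 1\<close>, and for
    larger \<open>u\<close> it is \<open>(1, 0)\<close> or \<open>(1, 1)\<close> according to
    whether \<open>m = 0\<close>.\<close>
  have "\<exists>t0 m0. excess u (2 * u - t0) (M - m0) r \<le> excess u (2 * u) M r
      \<and> (1 \<le> t0 \<or> t = t0) \<and> t0 \<le> t \<and> m0 \<le> m \<and> m0 \<le> 2"
  proof (cases "t = 0")
    case True
    then show ?thesis by (intro exI[of _ 0]) auto
  next
    case False
    then have "u \<noteq> 0" using t by auto
    show ?thesis
    proof (cases "u = 1")
      case True
      have "{2..3} = {2, 3::nat}" by auto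
      then have "X \<inter> {2, 3} \<noteq> {}" using False True by (auto simp: t_def)
      then have "2 \<le> card (X - {2, 3})"
        using eventually_EKR_card_ge assms by blast
      moreover have "X - {2, 3} = X \<inter> {4..n}" using assms(5) by force
      ultimately have "2 \<le> m" using True by (simp add: m_def)
      moreover have "excess 1 1 (n - 3 - 2) r \<le> excess 1 2 (n - 3) r"
        using excess_base_outside assms(1) nr by blast
      moreover have "M = n - 3" using True by (simp add: M_def)
      ultimately show ?thesis
        using False True by - (rule exI[of _ 1], rule exI[of _ 2], simp)
    next
      case False
      then have "2 \<le> u" using \<open>u \<noteq> 0\<close> by simp
      show ?thesis
      proof (cases "m = 0")
        case True
        have "\<not> X \<subseteq> {2..r + 1}"
          using eventually_EKR_not_subset assms \<open>\<not> (_ \<or> X = {})\<close> by simp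
        moreover have "X \<inter> {2 * u + 2..n} = {}" using True by (simp add: m_def)
        \<comment> \<open>Here \<open>X\<close> lies in \<open>[2,2u+1]\<close> but not in
          \<open>[2,r+1]\<close>.\<close>
        ultimately have "r < 2 * u" using assms(5) by force
        then have "excess u (2 * u - 1) (M - 0) r \<le> excess u (2 * u) M r"
          using excess_base_inside[of r n u] nr(1) u \<open>2 \<le> u\<close> by (simp add: M_def)
        then show ?thesis
          using \<open>t \<noteq> 0\<close> by - (rule exI[of _ 1], rule exI[of _ 0], simp)
      next
        case False
        have "excess u (2 * u - 1) (M - 1) r \<le> excess u (2 * u) M r"
          unfolding M_def using excess_base_mixed nr(1) u \<open>2 \<le> u\<close> by blast
        then show ?thesis
          using False \<open>t \<noteq> 0\<close> by (intro exI[of _ 1]) auto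
      qed
    qed
  qed
  then obtain t0 m0 where base: "excess u (2 * u - t0) (M - m0) r \<le> excess u (2 * u) M r"
    "1 \<le> t0 \<or> t = t0" "t0 \<le> t" "m0 \<le> m" "m0 \<le> 2" by blast
  have "excess u (2 * u - t) (M - m) r \<le> excess u (2 * u) M r"
    by (rule excess_extend[OF base(1,2,3) t base(4) m u(2)]) (use base(5) n u in \<open>auto simp: M_def\<close>)
  then have "card (hitting (threshold_family n r i) X) \<le> card (hitting (star n r) X)"
    using card_hitting_diff[OF u(2,3) assms(5)] by (simp add: u(1) M_def t_def m_def)
  moreover have "card (hitting (generated_family r n {G}) X) \<le> card (hitting (threshold_family n r i) X)"
    using i(3) finite_threshold_family by (intro card_mono) (auto simp: hitting_def)
  ultimately show ?thesis by linarith
qed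

end
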